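(* The monoid of input-output functions of acyclic boolean circuits, extended to right-ideal morphisms of $\{0,1\}^*$, is not finitely generated under function-composition. Likewise, the monoid of input-output functions of acyclic partial circuits, extended to right-ideal morphisms of $\{0,1\}^*$, is not finitely generated under function-composition.
   Context: An acyclic boolean circuit is a finite directed acyclic graph whose sources are labeled by input variables (fan-out 1), sinks by output variables (fan-in 1), and interior vertices by gates not (1 in, 1 out), and, or (2 in, 1 out), fork (1 in, 2 out; copies its input bit), with in- and out-degrees matching the gates. A partial circuit is defined in the same way, except that the set of gates is enlarged by a finite set of partial gates; here one may take the additional gate $\zeta_1$ with two input wires and one output wire, given by $\zeta_1(00)=0$, $\zeta_1(01)=1$, and undefined on $10$ and $11$. In a partial circuit, if some gate has undefined output for a given input then the whole output of the circuit is undefined for that input. A right-ideal morphism of $\{0,1\}^*$ is a partial function $f:\{0,1\}^*\to\{0,1\}^*$ whose domain is a right ideal (a set $R$ with $R=R\{0,1\}^*$) and such that $f(xu)=f(x)u$ for all $x\in\mathrm{Dom}(f)$, $u\in\{0,1\}^*$. The (partial) input-output function $f:\{0,1\}^m\to\{0,1\}^n$ of a circuit is extended to a right-ideal morphism by $f(xu)=f(x)u$ for $x\in\{0,1\}^m$ in the domain of $f$ and $u\in\{0,1\}^*$. With this extension, any two input-output functions can be composed, and the sets of extended input-output functions are monoids under composition. *)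

theory Defs
  imports "Graph_Theory.Digraph" "HOL-Algebra.Group"
begin

section \<open>Right-ideal morphisms\<close>

text \<open>Bit strings are boolean lists (0 is \<open>False\<close>, 1 is \<open>True\<close>); partial functions
  on strings are maps into \<open>option\<close>, with \<open>None\<close> for ``undefined''.\<close>

type_synonym bits = "bool list"

definition right_ideal :: "bits set \<Rightarrow> bool" where
  "right_ideal R \<longleftrightarrow> R = {x @ u | x u. x \<in> R}"

definition right_ideal_morphism :: "(bits \<rightharpoonup> bits) \<Rightarrow> bool" where
  "right_ideal_morphism f \<longleftrightarrow> right_ideal (dom f) \<and>
     (\<forall>x\<in>dom f. \<forall>u. f (x @ u) = map_option (\<lambda>y. y @ u) (f x))"

definition ri_extend :: "nat \<Rightarrow> (bits \<rightharpoonup> bits) \<Rightarrow> (bits \<rightharpoonup> bits)" where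
  "ri_extend m f w = (if m \<le> length w
     then map_option (\<lambda>y. y @ drop m w) (f (take m w)) else None)"

lemma ri_extend_append: "length x = m \<Longrightarrow> ri_extend m f (x @ u) = map_option (\<lambda>y. y @ u) (f x)"
  by (simp add: ri_extend_def)

lemma right_ideal_morphism_ri_extend: "right_ideal_morphism (ri_extend m f)"
  unfolding right_ideal_morphism_def right_ideal_def
proof (intro conjI ballI allI)
  show ext: "ri_extend m f (x @ u) = map_option (\<lambda>y. y @ u) (ri_extend m f x)"
    if "x \<in> dom (ri_extend m f)" for x u
    using that by (auto simp: ri_extend_def option.map_comp comp_def split: if_splits)
  show "dom (ri_extend m f) = {x @ u |x u. x \<in> dom (ri_extend m f)}" (is "?D = ?R")
  proof
    show "?D \<subseteq> ?R" by (metis (mono_tags, lifting) append_Nil2 mem_Collect_eq subsetI)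
    show "?R \<subseteq> ?D" using ext by (auto simp: dom_def)
  qed
qed


section \<open>Gates\<close>

datatype gate = Gate (ins: nat) (outs: nat) (gate_fun: "bits \<rightharpoonup> bits")

definition partial_gate :: "gate \<Rightarrow> bool" where
  "partial_gate g \<longleftrightarrow> 0 < ins g \<and> 0 < outs g \<and>
     (\<forall>x y. gate_fun g x = Some y \<longrightarrow> length x = ins g \<and> length y = outs g)"

definition not_gate :: gate where
  "not_gate = Gate 1 1 (\<lambda>x. case x of [a] \<Rightarrow> Some [\<not> a] | _ \<Rightarrow> None)"

definition and_gate :: gate where
  "and_gate = Gate 2 1 (\<lambda>x. case x of [a, b] \<Rightarrow> Some [a \<and> b] | _ \<Rightarrow> None)"

definition or_gate :: gate where
  "or_gate = Gate 2 1 (\<lambda>x. case x of [a, b] \<Rightarrow> Some [a \<or> b] | _ \<Rightarrow> None)"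

definition fork_gate :: gate where
  "fork_gate = Gate 1 2 (\<lambda>x. case x of [a] \<Rightarrow> Some [a, a] | _ \<Rightarrow> None)"

definition boolean_gates :: "gate set" where
  "boolean_gates = {not_gate, and_gate, or_gate, fork_gate}"

definition zeta1_gate :: gate where
  "zeta1_gate = Gate 2 1 (\<lambda>x. case x of [a, b] \<Rightarrow> if a then None else Some [b] | _ \<Rightarrow> None)"

lemma zeta1_values:
  "gate_fun zeta1_gate [False, False] = Some [False]"
  "gate_fun zeta1_gate [False, True] = Some [True]"
  "gate_fun zeta1_gate [True, False] = None"
  "gate_fun zeta1_gate [True, True] = None"
  by (simp_all add: zeta1_gate_def)

lemma partial_gate_zeta1: "partial_gate zeta1_gate"
  by (auto simp: partial_gate_def zeta1_gate_def split: list.splits if_splits)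

lemma partial_gate_boolean: "g \<in> boolean_gates \<Longrightarrow> partial_gate g"
  by (auto simp: boolean_gates_def partial_gate_def not_gate_def and_gate_def or_gate_def
      fork_gate_def split: list.splits)


section \<open>Acyclic circuits\<close>

datatype vertex_label = Input nat | Output nat | Interior gate

fun fan_in :: "vertex_label \<Rightarrow> nat" where
  "fan_in (Input i) = 0"
| "fan_in (Output j) = 1"
| "fan_in (Interior g) = ins g"

fun fan_out :: "vertex_label \<Rightarrow> nat" where
  "fan_out (Input i) = 1"
| "fan_out (Output j) = 0"
| "fan_out (Interior g) = outs g"

text \<open>The arcs of the graph are the wires; parallel wires are allowed (both outputs of a fork
  may enter the same gate).  Since gates need not be symmetric, \<open>in_wires v\<close> and
  \<open>out_wires v\<close> list the wires at \<open>v\<close> in the order of the arguments and results of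
  the gate.  Taking naturals as vertices and wires is no restriction, the graphs being finite.\<close>

record circuit =
  graph :: "(nat, nat) pre_digraph"
  vlabel :: "nat \<Rightarrow> vertex_label"
  in_wires :: "nat \<Rightarrow> nat list"
  out_wires :: "nat \<Rightarrow> nat list"
  num_in :: nat
  num_out :: nat

definition acyclic_circuit :: "gate set \<Rightarrow> circuit \<Rightarrow> bool" where
  "acyclic_circuit \<Gamma> C \<longleftrightarrow>
     fin_digraph (graph C) \<and> acyclic (arcs_ends (graph C)) \<and>
     (\<forall>v\<in>verts (graph C).
        distinct (in_wires C v) \<and> set (in_wires C v) = in_arcs (graph C) v \<and>
        length (in_wires C v) = fan_in (vlabel C v) \<and>
        distinct (out_wires C v) \<and> set (out_wires C v) = out_arcs (graph C) v \<and>
        length (out_wires C v) = fan_out (vlabel C v) \<and>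
        (case vlabel C v of
           Input i \<Rightarrow> i < num_in C
         | Output j \<Rightarrow> j < num_out C
         | Interior g \<Rightarrow> g \<in> \<Gamma>)) \<and>
     (\<forall>i<num_in C. \<exists>!v. v \<in> verts (graph C) \<and> vlabel C v = Input i) \<and>
     (\<forall>j<num_out C. \<exists>!v. v \<in> verts (graph C) \<and> vlabel C v = Output j)"

text \<open>An evaluation of a circuit on \<open>x\<close> puts a bit on every wire, in accordance with the
  inputs and with all gates.  There is none if some gate is undefined on the bits it receives,
  whether or not an output depends on that gate.\<close>

definition evaluation :: "circuit \<Rightarrow> bits \<Rightarrow> (nat \<Rightarrow> bool) \<Rightarrow> bool" where
  "evaluation C x val \<longleftrightarrow> (\<forall>v\<in>verts (graph C). case vlabel C v of
       Input i \<Rightarrow> map val (out_wires C v) = [x ! i]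
     | Output j \<Rightarrow> True
     | Interior g \<Rightarrow> gate_fun g (map val (in_wires C v)) = Some (map val (out_wires C v)))"

definition computes :: "circuit \<Rightarrow> bits \<Rightarrow> bits \<Rightarrow> bool" where
  "computes C x y \<longleftrightarrow> length x = num_in C \<and> length y = num_out C \<and>
     (\<exists>val. evaluation C x val \<and>
        (\<forall>v\<in>verts (graph C). \<forall>j. vlabel C v = Output j \<longrightarrow> map val (in_wires C v) = [y ! j]))"

definition io_function :: "circuit \<Rightarrow> bits \<rightharpoonup> bits" where
  "io_function C x = (if \<exists>y. computes C x y then Some (THE y. computes C x y) else None)"

lemma evaluation_unique:
  assumes C: "acyclic_circuit \<Gamma> C"
    and ev: "evaluation C x val" "evaluation C x val'"
    and e: "e \<in> arcs (graph C)"
  shows "val e = val' e"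
proof -
  let ?G = "graph C"
  interpret fin_digraph ?G using C by (simp add: acyclic_circuit_def)
  have "wf (arcs_ends ?G)"
    using C by (intro finite_acyclic_wf) (auto simp: acyclic_circuit_def arcs_ends_def)
  then have all: "v \<in> verts ?G \<Longrightarrow> \<forall>e\<in>out_arcs ?G v. val e = val' e" for v
  proof (induction v rule: wf_induct_rule)
    case (less v)
    from C less.prems have ins: "set (in_wires C v) = in_arcs ?G v"
      and outs: "set (out_wires C v) = out_arcs ?G v"
      and len: "length (out_wires C v) = fan_out (vlabel C v)"
      unfolding acyclic_circuit_def by auto
    have "map val (in_wires C v) = map val' (in_wires C v)"
    proof (rule map_cong[OF refl])
      fix e assume "e \<in> set (in_wires C v)"
      with ins have e: "e \<in> arcs ?G" "head ?G e = v" by auto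
      then have "(tail ?G e, v) \<in> arcs_ends ?G" by (auto simp: arcs_ends_conv)
      with less.IH e show "val e = val' e" by simp
    qed
    moreover from less.prems ev
    have "case vlabel C v of Input i \<Rightarrow> map val (out_wires C v) = [x ! i] | Output j \<Rightarrow> True
        | Interior g \<Rightarrow> gate_fun g (map val (in_wires C v)) = Some (map val (out_wires C v))"
      and "case vlabel C v of Input i \<Rightarrow> map val' (out_wires C v) = [x ! i] | Output j \<Rightarrow> True
        | Interior g \<Rightarrow> gate_fun g (map val' (in_wires C v)) = Some (map val' (out_wires C v))"
      unfolding evaluation_def by blast+
    ultimately have "map val (out_wires C v) = map val' (out_wires C v)"
      using len by (cases "vlabel C v") (simp_all del: map_eq_conv)
    with outs show ?case by (metis map_eq_conv)
  qed
  from all[of "tail ?G e"] e show ?thesis by simp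
qed

lemma computes_unique:
  assumes C: "acyclic_circuit \<Gamma> C" and "computes C x y" "computes C x y'"
  shows "y = y'"
proof -
  from assms obtain val val' where len: "length y = num_out C" "length y' = num_out C"
    and ev: "evaluation C x val" "evaluation C x val'"
    and out: "\<And>v j. v \<in> verts (graph C) \<Longrightarrow> vlabel C v = Output j \<Longrightarrow>
        map val (in_wires C v) = [y ! j] \<and> map val' (in_wires C v) = [y' ! j]"
    unfolding computes_def by metis
  have "y ! j = y' ! j" if j: "j < num_out C" for j
  proof -
    from C j obtain v where v: "v \<in> verts (graph C)" "vlabel C v = Output j"
      unfolding acyclic_circuit_def by blast
    then have "set (in_wires C v) \<subseteq> arcs (graph C)"
      using C unfolding acyclic_circuit_def by auto
    then have "map val (in_wires C v) = map val' (in_wires C v)"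
      using evaluation_unique[OF C ev] by auto
    moreover from out[OF v] have "map val (in_wires C v) = [y ! j]"
      and "map val' (in_wires C v) = [y' ! j]" by blast+
    ultimately show ?thesis by simp
  qed
  with len show ?thesis by (simp add: nth_equalityI)
qed

lemma io_function_eq_Some_iff:
  assumes "acyclic_circuit \<Gamma> C"
  shows "io_function C x = Some y \<longleftrightarrow> computes C x y"
proof -
  have "(THE z. computes C x z) = y" if "computes C x y" for y
    using that computes_unique[OF assms] by blast
  then show ?thesis unfolding io_function_def by auto
qed


section \<open>The monoids of extended input-output functions\<close>

text \<open>The product is composition of partial functions, \<open>(g \<cdot> f)(w) = g(f(w))\<close>.  The unit, the
  identity on all strings, is given by the empty circuit.\<close>

definition io_monoid :: "gate set \<Rightarrow> (bits \<rightharpoonup> bits) monoid" where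
  "io_monoid \<Gamma> =
     \<lparr>carrier = {ri_extend (num_in C) (io_function C) | C. acyclic_circuit \<Gamma> C},
      mult = (\<lambda>g f. g \<circ>\<^sub>m f), one = Some\<rparr>"

lemma one_in_io_monoid: "one (io_monoid \<Gamma>) \<in> carrier (io_monoid \<Gamma>)"
proof -
  define C :: circuit where "C = \<lparr>graph = \<lparr>verts = {}, arcs = {}, tail = id, head = id\<rparr>,
    vlabel = Input, in_wires = (\<lambda>_. []), out_wires = (\<lambda>_. []), num_in = 0, num_out = 0\<rparr>"
  have C: "acyclic_circuit \<Gamma> C"
    by (auto simp: acyclic_circuit_def C_def arcs_ends_def acyclic_def
        fin_digraph_def fin_digraph_axioms_def wf_digraph_def)
  have "io_function C [] = Some []"
    unfolding io_function_eq_Some_iff[OF C] by (simp add: computes_def evaluation_def C_def)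
  then have "ri_extend (num_in C) (io_function C) = Some"
    by (intro ext) (simp add: ri_extend_def C_def)
  with C have "Some \<in> {ri_extend (num_in C) (io_function C) | C. acyclic_circuit \<Gamma> C}"
    by (metis (mono_tags, lifting) mem_Collect_eq)
  then show ?thesis by (simp add: io_monoid_def)
qed

definition finitely_generated_monoid :: "('a, 'b) monoid_scheme \<Rightarrow> bool" where
  "finitely_generated_monoid M \<longleftrightarrow>
     (\<exists>S. finite S \<and> S \<subseteq> carrier M \<and>
        (\<forall>x\<in>carrier M. \<exists>xs. set xs \<subseteq> S \<and> x = foldr (mult M) xs (one M)))"

end

theory Submission
  imports Defs
begin

text \<open>Both claims are instances of one fact about an arbitrary set of gates,
  \<open>io_monoid_not_finitely_generated\<close>.

  An extended input-output function with \<open>m\<close> inputs rewrites a prefix of length \<open>m\<close> and leaves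
  the rest of the string alone.  Finitely many generators therefore rewrite only prefixes of
  length at most some \<open>K\<close>, and a product of generators works like a stack machine without
  internal state: to get at a bit far from the front it must first shrink everything in front of
  that bit to fewer than \<open>K\<close> bits.  If those were arbitrary bits, and at least \<open>K\<close> of them, this
  loses information.  So a product which is defined and injective on the strings \<open>x @ u\<close>
  (\<open>x\<close> of length at least \<open>K\<close>, \<open>u\<close> fixed) never changes the suffix \<open>u\<close>; this is
  \<open>injective_product_keeps_suffix\<close>.

  String reversal on \<open>K + 2\<close> bits is total and injective, and it is computed by a circuit that
  consists of crossed wires only, without any gate.  But it does not preserve the last bit, so
  it is not a product of the given generators.\<close>

text \<open>The common length of the outputs is what makes the pigeonhole principle available; it is
  guaranteed for input-output functions, but not for right-ideal morphisms in general.\<close>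

definition rewrites_short_prefix :: "nat \<Rightarrow> (bits \<rightharpoonup> bits) \<Rightarrow> bool" where
  "rewrites_short_prefix K s \<longleftrightarrow>
     (\<exists>m f l. m \<le> K \<and> s = ri_extend m f \<and> (\<forall>x y. f x = Some y \<longrightarrow> length y = l))"

lemma rewrites_short_prefix_mono:
  "rewrites_short_prefix K s \<Longrightarrow> K \<le> L \<Longrightarrow> rewrites_short_prefix L s"
  unfolding rewrites_short_prefix_def using le_trans by blast

lemma length_le_if_inj_on_bits:
  fixes y :: "bits \<Rightarrow> bits"
  assumes "inj_on y {x. length x = n}" and "\<And>x. length x = n \<Longrightarrow> length (y x) = l"
  shows "n \<le> l"
proof -
  have card: "card {x :: bits. length x = k} = 2 ^ k" for k
    using card_lists_length_eq[of "UNIV :: bool set" k] by simp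
  have fin: "finite {x :: bits. length x = l}"
    using finite_lists_length_eq[of "UNIV :: bool set" l] by simp
  have "card {x :: bits. length x = n} \<le> card {x :: bits. length x = l}"
    by (rule card_inj_on_le[OF assms(1) _ fin]) (auto simp: assms(2))
  then show ?thesis by (simp add: card)
qed

text \<open>By induction, a partial product acts as \<open>x @ u \<mapsto> y x @ u\<close> with \<open>y\<close> injective and of
  constant output length.  By counting, \<open>y x\<close> is at least as long as \<open>x\<close>, hence at least as
  long as the prefix that the next factor rewrites; so that factor does not reach \<open>u\<close> either.\<close>

lemma injective_product_keeps_suffix:
  assumes "\<forall>s\<in>set ss. rewrites_short_prefix n s"
    and "\<And>x. length x = n \<Longrightarrow> foldr (\<circ>\<^sub>m) ss Some (x @ u) \<noteq> None"
    and "inj_on (\<lambda>x. foldr (\<circ>\<^sub>m) ss Some (x @ u)) {x. length x = n}"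
  shows "\<exists>y l. \<forall>x. length x = n \<longrightarrow>
           foldr (\<circ>\<^sub>m) ss Some (x @ u) = Some (y x @ u) \<and> length (y x) = l"
  using assms
proof (induction ss)
  case Nil
  show ?case by (rule exI[of _ "\<lambda>x. x"]) simp
next
  case (Cons s ss)
  let ?h = "foldr (\<circ>\<^sub>m) ss Some"
  have comp: "foldr (\<circ>\<^sub>m) (s # ss) Some w = (case ?h w of None \<Rightarrow> None | Some v \<Rightarrow> s v)" for w
    by (simp add: map_comp_def)
  have def: "?h (x @ u) \<noteq> None" if "length x = n" for x
    using Cons.prems(2)[OF that] unfolding comp by (auto split: option.splits)
  have inj: "inj_on (\<lambda>x. ?h (x @ u)) {x. length x = n}"
    using Cons.prems(3) unfolding comp inj_on_def by metis
  obtain y l where y: "\<And>x. length x = n \<Longrightarrow> ?h (x @ u) = Some (y x @ u)"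
    and l: "\<And>x. length x = n \<Longrightarrow> length (y x) = l"
    using Cons.IH[OF _ def inj] Cons.prems(1) by auto
  have "inj_on y {x. length x = n}"
    using inj y by (auto simp: inj_on_def)
  then have "n \<le> l" using l by (rule length_le_if_inj_on_bits)
  moreover obtain m f k where m: "m \<le> n" and s: "s = ri_extend m f"
    and k: "\<And>x z. f x = Some z \<Longrightarrow> length z = k"
    using Cons.prems(1) by (auto simp: rewrites_short_prefix_def)
  ultimately have "m \<le> l" by simp
  let ?z = "\<lambda>x. the (f (take m (y x))) @ drop m (y x)"
  have "foldr (\<circ>\<^sub>m) (s # ss) Some (x @ u) = Some (?z x @ u) \<and> length (?z x) = k + (l - m)"
    if x: "length x = n" for x
  proof -
    have eq: "foldr (\<circ>\<^sub>m) (s # ss) Some (x @ u)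
        = map_option (\<lambda>v. v @ drop m (y x) @ u) (f (take m (y x)))"
      using \<open>m \<le> l\<close> l[OF x] by (simp add: map_comp_def y[OF x] s ri_extend_def)
    with Cons.prems(2)[OF x] obtain z where "f (take m (y x)) = Some z"
      by (cases "f (take m (y x))") auto
    with eq k l[OF x] show ?thesis by simp
  qed
  then show ?case by (intro exI[of _ ?z] exI[of _ "k + (l - m)"]) blast
qed

lemma rewrites_short_prefix_io_function:
  assumes "acyclic_circuit \<Gamma> C"
  shows "rewrites_short_prefix (num_in C) (ri_extend (num_in C) (io_function C))"
  unfolding rewrites_short_prefix_def
  using io_function_eq_Some_iff[OF assms] by (metis computes_def order_refl)

lemma finite_subset_io_monoid_rewrites_short_prefix:
  assumes "finite S" and "S \<subseteq> carrier (io_monoid \<Gamma>)"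
  obtains K where "\<forall>s\<in>S. rewrites_short_prefix K s"
proof -
  have "\<exists>k. rewrites_short_prefix k s" if "s \<in> S" for s
    using that assms(2) rewrites_short_prefix_io_function by (fastforce simp: io_monoid_def)
  then obtain k where k: "\<And>s. s \<in> S \<Longrightarrow> rewrites_short_prefix (k s) s" by metis
  have "\<forall>s\<in>S. rewrites_short_prefix (Max (k ` S)) s"
    using k rewrites_short_prefix_mono assms(1) by (meson Max_ge finite_imageI image_eqI)
  then show ?thesis by (rule that)
qed

text \<open>The order of the bits is reversed by the numbering of the output vertices alone.  The wires
  just shift vertex numbers up by \<open>m\<close>, so the graph is acyclic because every wire increases the
  vertex number.\<close>

definition reversal_circuit :: "nat \<Rightarrow> circuit" where
  "reversal_circuit m = \<lparr>graph = \<lparr>verts = {..<2 * m}, arcs = {..<m}, tail = id, head = (+) m\<rparr>,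
     vlabel = (\<lambda>v. if v < m then Input v else Output (2 * m - 1 - v)),
     in_wires = (\<lambda>v. if v < m then [] else [v - m]),
     out_wires = (\<lambda>v. if v < m then [v] else []),
     num_in = m, num_out = m\<rparr>"

lemma acyclic_circuit_reversal: "acyclic_circuit \<Gamma> (reversal_circuit m)"
proof -
  let ?C = "reversal_circuit m"
  have "arcs_ends (graph ?C) \<subseteq> less_than"
    by (auto simp: reversal_circuit_def arcs_ends_def arc_to_ends_def)
  then have "acyclic (arcs_ends (graph ?C))"
    by (rule acyclic_subset[OF wf_acyclic[OF wf_less_than]])
  moreover have "fin_digraph (graph ?C)"
    by unfold_locales (auto simp: reversal_circuit_def)
  moreover have "\<exists>!v. v \<in> verts (graph ?C) \<and> vlabel ?C v = Input i" if "i < m" for i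
    using that by (intro ex1I[of _ i]) (auto simp: reversal_circuit_def split: if_splits)
  moreover have "\<exists>!v. v \<in> verts (graph ?C) \<and> vlabel ?C v = Output j" if "j < m" for j
    using that by (intro ex1I[of _ "2 * m - 1 - j"]) (auto simp: reversal_circuit_def split: if_splits)
  moreover have "in_arcs (graph ?C) v = set (in_wires ?C v)"
    and "out_arcs (graph ?C) v = set (out_wires ?C v)" if "v < 2 * m" for v
    using that by (auto simp: reversal_circuit_def in_arcs_def out_arcs_def)
  ultimately show ?thesis
    unfolding acyclic_circuit_def by (auto simp: reversal_circuit_def)
qed

lemma io_function_reversal:
  assumes "length x = m"
  shows "io_function (reversal_circuit m) x = Some (rev x)"
  unfolding io_function_eq_Some_iff[OF acyclic_circuit_reversal] computes_def evaluation_def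
  using assms
  by (auto simp: reversal_circuit_def rev_nth intro!: exI[of _ "(!) x"] arg_cong[of _ _ "(!) x"])

theorem io_monoid_not_finitely_generated: "\<not> finitely_generated_monoid (io_monoid \<Gamma>)"
proof
  assume "finitely_generated_monoid (io_monoid \<Gamma>)"
  then obtain S where S: "finite S" "S \<subseteq> carrier (io_monoid \<Gamma>)"
    and gen: "\<And>f. f \<in> carrier (io_monoid \<Gamma>) \<Longrightarrow>
      \<exists>ss. set ss \<subseteq> S \<and> f = foldr (\<circ>\<^sub>m) ss Some"
    unfolding finitely_generated_monoid_def by (auto simp: io_monoid_def)
  obtain K where K: "\<forall>s\<in>S. rewrites_short_prefix K s"
    using finite_subset_io_monoid_rewrites_short_prefix[OF S] .
  \<comment> \<open>The successor makes room for a first bit that differs from the last one, even if \<open>K = 0\<close>.\<close>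
  define n where "n = Suc K"
  let ?C = "reversal_circuit (Suc n)"
  let ?f = "ri_extend (num_in ?C) (io_function ?C)"
  have "num_in ?C = Suc n" by (simp add: reversal_circuit_def)
  then have f: "?f (x @ [True]) = Some (True # rev x)" if "length x = n" for x
    using that io_function_reversal[of "x @ [True]" "Suc n"] by (simp add: ri_extend_def)
  have "?f \<in> carrier (io_monoid \<Gamma>)"
    unfolding io_monoid_def using acyclic_circuit_reversal by auto
  then obtain ss where ss: "set ss \<subseteq> S" and f_ss: "?f = foldr (\<circ>\<^sub>m) ss Some"
    using gen by blast
  have "\<exists>y l. \<forall>x. length x = n \<longrightarrow>
      foldr (\<circ>\<^sub>m) ss Some (x @ [True]) = Some (y x @ [True]) \<and> length (y x) = l"
  proof (rule injective_product_keeps_suffix)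
    show "\<forall>s\<in>set ss. rewrites_short_prefix n s"
      using ss K rewrites_short_prefix_mono[of K _ n] by (auto simp: n_def)
  qed (auto simp: f_ss[symmetric] f inj_on_def)
  then obtain y where y: "\<And>x. length x = n \<Longrightarrow> ?f (x @ [True]) = Some (y x @ [True])"
    unfolding f_ss by blast
  let ?x = "replicate n False"
  have "True # rev ?x = y ?x @ [True]"
    using f[of ?x] y[of ?x] by simp
  then have "last (True # rev ?x) = True" by simp
  then show False by (simp add: n_def)
qed

theorem theorem6p3:
  shows "\<not> finitely_generated_monoid (io_monoid boolean_gates) \<and>
    (\<forall>P. finite P \<and> (\<forall>p\<in>P. partial_gate p) \<longrightarrow>
      \<not> finitely_generated_monoid (io_monoid (boolean_gates \<union> P)))"
  using io_monoid_not_finitely_generated by blast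

end
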